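(* Consider the system $$\dot x_s=A_sx_s+f(x_s,x_c),\qquad \dot x_c=g(x_s,x_c),\qquad x_s\in\mathbb R^s,\ x_c\in\mathbb R^c,$$ where all eigenvalues of $A_s$ have negative real part and $f,g$ are $C^r$ ($r\ge2$) with $f,g$ and their gradients vanishing at the origin. Assume the origin is not isolated in the set of equilibrium points. Let $h:\mathcal N_c\to\mathbb R^s$ be the center manifold map and $E_c\subset\mathbb R^c$ the projection of the set $E$ of equilibrium points. Suppose $\alpha:\mathcal N_c\to\mathbb R^s$ satisfies $|\alpha(x_c)|\le|x_c|$ for all $x_c\in\mathcal N_c$ and $$A_s\alpha(x_c)+f(\alpha(x_c),x_c)=\mathrm{dist}(x_c,E_c)\,\mathcal O(|x_c|).$$ Then $$|h(x_c)-\alpha(x_c)|=\mathrm{dist}(x_c,E_c)\,\mathcal O(|x_c|),$$ and $$|g(h(x_c),x_c)-g(\alpha(x_c),x_c)|=\mathrm{dist}(x_c,E_c)\,\mathcal O(|x_c|^2).$$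
   Context: $\mathcal N_c$ is a sufficiently small neighborhood of $0\in\mathbb R^c$. The center manifold map $h:\mathcal N_c\to\mathbb R^s$ satisfies $h(0)=0$, $\nabla h(0)=0$, and its graph $\{(h(x_c),x_c)\}$ is locally invariant under the system. $E$ is the set of equilibrium points of the system near the origin, $E_c$ its image under $(x_s,x_c)\mapsto x_c$ (so $0\in E_c$), and $\mathrm{dist}(x_c,E_c)$ is the Euclidean distance. Writing a quantity as $\mathrm{dist}(x_c,E_c)\,\mathcal O(|x_c|^p)$ means its magnitude is at most $C\,\mathrm{dist}(x_c,E_c)|x_c|^p$ for $x_c$ near $0$, for some constant $C$. *)

theory Defs
  imports "HOL-Analysis.Analysis"
begin

definition matrix_eigenvalue :: "complex ^ 'n ^ 'n \<Rightarrow> complex \<Rightarrow> bool" where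
  "matrix_eigenvalue A \<mu> \<longleftrightarrow> (\<exists>v. v \<noteq> 0 \<and> A *v v = \<mu> *s v)"

(* The eigenvalues of a real matrix are its complex ones. *)
definition hurwitz :: "real ^ 'n ^ 'n \<Rightarrow> bool" where
  "hurwitz A \<longleftrightarrow> (\<forall>\<mu>. matrix_eigenvalue (map_matrix complex_of_real A) \<mu> \<longrightarrow> Re \<mu> < 0)"

(* Class C^k on an open set S.  The derivative is taken along fixed directions v so that the
   recursion stays within one type; in finite dimension, continuity of all the maps
   x \<mapsto> Df(x) v is the same as continuity of Df. *)
primrec C_diff_on ::
  "nat \<Rightarrow> 'a::euclidean_space set \<Rightarrow> ('a \<Rightarrow> 'b::euclidean_space) \<Rightarrow> bool" where
  "C_diff_on 0 S f \<longleftrightarrow> continuous_on S f"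
| "C_diff_on (Suc k) S f \<longleftrightarrow>
     (\<forall>x\<in>S. f differentiable (at x)) \<and>
     (\<forall>v. C_diff_on k S (\<lambda>x. frechet_derivative f (at x) v))"

definition system_field ::
  "real ^ 's ^ 's \<Rightarrow> ((real ^ 's) \<times> (real ^ 'c) \<Rightarrow> real ^ 's) \<Rightarrow>
   ((real ^ 's) \<times> (real ^ 'c) \<Rightarrow> real ^ 'c) \<Rightarrow>
   (real ^ 's) \<times> (real ^ 'c) \<Rightarrow> (real ^ 's) \<times> (real ^ 'c)" where
  "system_field A f g = (\<lambda>(xs, xc). (A *v xs + f (xs, xc), g (xs, xc)))"

definition equilibria :: "('a \<Rightarrow> 'a::zero) \<Rightarrow> 'a set" where
  "equilibria F = {p. F p = 0}"

(* The solution starting at a point of M stays in M for |t| < T, for some T > 0 depending on the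
   point.  The fields used here are C^1, so that the solution is unique and "there is a solution
   that stays" says the same as "the solution stays". *)
definition locally_invariant :: "('a::real_normed_vector \<Rightarrow> 'a) \<Rightarrow> 'a set \<Rightarrow> bool" where
  "locally_invariant F M \<longleftrightarrow>
     (\<forall>p\<in>M. \<exists>T>0. \<exists>x. x 0 = p \<and>
        (\<forall>t\<in>{-T<..<T}. (x has_vector_derivative F (x t)) (at t) \<and> x t \<in> M))"

(* C^1 is the least smoothness under which a center manifold is considered; the C^r center
   manifolds of a C^r system are included. *)
definition center_manifold_map ::
  "((real ^ 's) \<times> (real ^ 'c) \<Rightarrow> (real ^ 's) \<times> (real ^ 'c)) \<Rightarrow>
   (real ^ 'c) set \<Rightarrow> (real ^ 'c \<Rightarrow> real ^ 's) \<Rightarrow> bool" where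
  "center_manifold_map F N h \<longleftrightarrow>
     C_diff_on 1 N h \<and> h 0 = 0 \<and> (h has_derivative (\<lambda>_. 0)) (at 0) \<and>
     locally_invariant F ((\<lambda>xc. (h xc, xc)) ` N)"

(* q(x) = dist(x, E) O(|x|^p) as x tends to 0. *)
definition dist_bigo ::
  "('a::real_normed_vector \<Rightarrow> 'b::real_normed_vector) \<Rightarrow> 'a set \<Rightarrow> nat \<Rightarrow> bool" where
  "dist_bigo q E p \<longleftrightarrow>
     (\<exists>C. \<forall>\<^sub>F x in nhds 0. norm (q x) \<le> C * infdist x E * norm x ^ p)"

end

theory Submission
  imports Defs
begin

text \<open>
  Write \<open>G y x = A y + f (y, x)\<close>.  Invariance of the graph of \<open>h\<close> gives the equation
  \<open>G (h x) x = Dh(x) (g (h x, x))\<close> (\<open>invariant_graph_equation\<close>).  As \<open>A\<close> is Hurwitz it is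
  invertible, and as \<open>f\<close> has a small Lipschitz constant near the origin, \<open>G\<close> is bounded below in
  its first argument: \<open>norm (G y x - G y' x)\<close> is at least a positive multiple of
  \<open>norm (y - y')\<close>.  This is the only use of the spectrum of \<open>A\<close>.

  If \<open>(y, e)\<close> is an equilibrium near the origin, then \<open>G y e = 0\<close> and \<open>g (y, e) = 0\<close>, so
  \<open>norm (G (h e) e)\<close> is at most a small multiple of
  \<open>norm (g (h e, e) - g (y, e))\<close>, because \<open>Dh(e)\<close> is small.  The lower bound then forces
  \<open>h e = y\<close>: equilibria lie on the graph, with no appeal to the dynamics beyond the
  invariance equation.

  Since \<open>g\<close> is twice differentiable with vanishing gradient at the origin, its Lipschitz constant on
  a ball of radius \<open>s\<close> is \<open>O(s)\<close> (\<open>C2_critical_point_Lipschitz\<close>).  Comparing \<open>g (h x, x)\<close>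
  with its value \<open>0\<close> at an almost nearest point of \<open>Ec\<close> (\<open>le_infdist_of_le_dist\<close>) yields
  \<open>g (h x, x) = dist(x, Ec) O(norm x)\<close>, hence the same for the residual \<open>G (h x) x\<close>.  The residual of
  \<open>\<alpha>\<close> has this order by assumption, so the lower bound for \<open>G\<close> gives the estimate of
  \<open>h x - \<alpha> x\<close>, and the Lipschitz bound for \<open>g\<close> contributes the further factor \<open>norm x\<close>.
\<close>

section \<open>The linear part\<close>

text \<open>A real kernel vector would be a complex eigenvector for the eigenvalue \<open>0\<close>, whose real part
  is not negative.\<close>
lemma hurwitz_bounded_below:
  fixes A :: "real ^ 's ^ 's"
  assumes "hurwitz A"
  obtains c where "c > 0" "\<And>y. c * norm y \<le> norm (A *v y)"
proof -
  have "y = 0" if y: "A *v y = 0" for y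
  proof (rule ccontr)
    assume "y \<noteq> 0"
    define v where "v = (\<chi> i. complex_of_real (y $ i))"
    have "v \<noteq> 0"
      using \<open>y \<noteq> 0\<close> by (auto simp: v_def vec_eq_iff)
    moreover have "map_matrix complex_of_real A *v v = 0 *s v"
    proof -
      have "(\<Sum>j\<in>UNIV. complex_of_real (A $ i $ j) * complex_of_real (y $ j)) = 0" for i
      proof -
        have "(\<Sum>j\<in>UNIV. complex_of_real (A $ i $ j) * complex_of_real (y $ j))
            = complex_of_real ((A *v y) $ i)"
          by (simp add: matrix_vector_mult_def)
        then show ?thesis
          by (simp add: y)
      qed
      then show ?thesis
        by (simp add: vec_eq_iff matrix_vector_mult_def v_def map_matrix_def)
    qed
    ultimately have "matrix_eigenvalue (map_matrix complex_of_real A) 0"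
      unfolding matrix_eigenvalue_def by blast
    with assms show False
      unfolding hurwitz_def by fastforce
  qed
  then have "inj ((*v) A)"
    by (subst linear_injective_0) auto
  then obtain c where "c > 0" "\<And>y. norm (A *v y) \<ge> c * norm y"
    using linear_inj_bounded_below_pos[of "(*v) A"] by auto
  then show thesis
    using that by blast
qed

section \<open>Quantitative bounds near a critical point\<close>

lemma norm_linear_le_Basis:
  fixes L :: "'a::euclidean_space \<Rightarrow> 'b::real_normed_vector"
  assumes "linear L" and "\<And>b. b \<in> Basis \<Longrightarrow> norm (L b) \<le> B"
  shows "norm (L v) \<le> real DIM('a) * B * norm v"
proof -
  have "L v = L (\<Sum>b\<in>Basis. (v \<bullet> b) *\<^sub>R b)"
    by (simp add: euclidean_representation)
  also have "\<dots> = (\<Sum>b\<in>Basis. (v \<bullet> b) *\<^sub>R L b)"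
    using assms(1) by (simp add: linear_sum linear_cmul)
  also have "norm \<dots> \<le> (\<Sum>b\<in>(Basis::'a set). norm v * B)"
  proof (rule sum_norm_le)
    fix b :: 'a assume "b \<in> Basis"
    then show "norm ((v \<bullet> b) *\<^sub>R L b) \<le> norm v * B"
      using assms(2)[of b] Basis_le_norm[of b v] by (auto intro: mult_mono)
  qed
  finally show ?thesis
    by (simp add: mult_ac)
qed

lemma C_diff_on_Suc_has_derivative:
  assumes "C_diff_on (Suc k) S f" "x \<in> S"
  shows "(f has_derivative frechet_derivative f (at x)) (at x)"
  using assms frechet_derivative_works by auto

text \<open>If \<^term>\<open>\<phi>\<close> is twice differentiable and its derivative vanishes at the origin, then the
  derivative at \<^term>\<open>x\<close> is of size \<open>O(norm x)\<close>, so the mean value inequality gives Lipschitz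
  constants of size \<open>O(s)\<close> on balls of radius \<^term>\<open>s\<close>.\<close>
lemma C2_critical_point_Lipschitz:
  fixes \<phi> :: "'a::euclidean_space \<Rightarrow> 'b::euclidean_space"
  assumes "2 \<le> r" "C_diff_on r UNIV \<phi>" "(\<phi> has_derivative (\<lambda>_. 0)) (at 0)"
  obtains K \<delta> where "K \<ge> 0" "\<delta> > 0"
    "\<And>s x y. s \<le> \<delta> \<Longrightarrow> norm x \<le> s \<Longrightarrow> norm y \<le> s \<Longrightarrow>
       norm (\<phi> x - \<phi> y) \<le> K * s * norm (x - y)"
proof -
  obtain k where k: "r = Suc (Suc k)"
    using assms(1) by (metis add_2_eq_Suc le_Suc_ex)
  let ?D = "\<lambda>x. frechet_derivative \<phi> (at x)"
  have D: "(\<phi> has_derivative ?D x) (at x)" for x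
    using assms(2) C_diff_on_Suc_has_derivative unfolding k by blast
  have D0: "?D 0 = (\<lambda>_. 0)"
    using frechet_derivative_at[OF assms(3)] by simp
  have diffD: "(\<lambda>x. ?D x v) differentiable (at 0)" for v
    using assms(2) unfolding k by simp
  have "\<exists>B. B > 0 \<and> (\<forall>\<^sub>F x in nhds 0. norm (?D x v) \<le> B * norm x)" for v
  proof -
    let ?L = "frechet_derivative (\<lambda>x. ?D x v) (at 0)"
    have L: "((\<lambda>x. ?D x v) has_derivative ?L) (at 0)"
      using diffD frechet_derivative_works by blast
    then obtain B where B: "B > 0" "\<And>x. norm (?L x) \<le> norm x * B"
      using bounded_linear.pos_bounded has_derivative_bounded_linear by metis
    obtain d where d: "d > 0"
      "\<And>y. norm (y - 0) < d \<Longrightarrow> norm (?D y v - ?D 0 v - ?L (y - 0)) \<le> 1 * norm (y - 0)"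
      using L unfolding has_derivative_at_alt by (metis zero_less_one)
    have "norm (?D y v) \<le> (B + 1) * norm y" if "norm y < d" for y
    proof -
      have "norm (?D y v - ?L y) \<le> norm y"
        using d(2)[of y] that by (simp add: D0)
      moreover have "norm (?D y v) \<le> norm (?D y v - ?L y) + norm (?L y)"
        by (metis norm_triangle_sub add.commute)
      ultimately show ?thesis
        using B(2)[of y] by (simp add: algebra_simps)
    qed
    then have "\<forall>\<^sub>F x in nhds 0. norm (?D x v) \<le> (B + 1) * norm x"
      using d(1) by (auto simp: eventually_nhds_metric)
    then show ?thesis
      using B(1) by (intro exI[of _ "B + 1"]) auto
  qed
  then obtain B where B: "\<And>v. B v > 0"
      "\<And>v. \<forall>\<^sub>F x in nhds 0. norm (?D x v) \<le> B v * norm x"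
    by metis
  have "\<forall>\<^sub>F x in nhds 0. \<forall>b\<in>Basis. norm (?D x b) \<le> B b * norm x"
    using B(2) by (simp add: eventually_ball_finite)
  then obtain \<delta>' where \<delta>': "\<delta>' > 0"
      "\<And>x b. norm x < \<delta>' \<Longrightarrow> b \<in> Basis \<Longrightarrow> norm (?D x b) \<le> B b * norm x"
    by (auto simp: eventually_nhds_metric)
  define M where "M = (\<Sum>b\<in>(Basis::'a set). B b)"
  have M: "B b \<le> M" if "b \<in> Basis" for b
    unfolding M_def using that B(1) by (intro member_le_sum) (auto intro: less_imp_le)
  have "M \<ge> 0"
    unfolding M_def using B(1) by (intro sum_nonneg) (auto intro: less_imp_le)
  define K where "K = real DIM('a) * M"
  show thesis
  proof (rule that[of K "\<delta>' / 2"])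
    show "K \<ge> 0" "\<delta>' / 2 > 0"
      using \<open>M \<ge> 0\<close> \<delta>'(1) by (auto simp: K_def)
    fix s and x y :: 'a
    assume s: "s \<le> \<delta>' / 2" "norm x \<le> s" "norm y \<le> s"
    have "onorm (?D z) \<le> K * s" if z: "z \<in> cball 0 s" for z
    proof (rule onorm_bound)
      have "norm z < \<delta>'" "norm z \<le> s"
        using z s \<delta>'(1) by auto
      then have "norm (?D z b) \<le> M * s" if "b \<in> Basis" for b
        using \<delta>'(2)[of z b] M[of b] that B(1)[of b] \<open>M \<ge> 0\<close>
        by (meson mult_mono norm_ge_zero order_trans)
      then show "norm (?D z v) \<le> K * s * norm v" for v
        using norm_linear_le_Basis[of "?D z" "M * s" v] has_derivative_linear[OF D]
        by (simp add: K_def mult.assoc)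
      show "0 \<le> K * s"
        using \<open>K \<ge> 0\<close> s by (smt (verit) mult_nonneg_nonneg norm_ge_zero)
    qed
    then show "norm (\<phi> x - \<phi> y) \<le> K * s * norm (x - y)"
      using s by (intro differentiable_bound[of "cball 0 s" \<phi> ?D])
        (auto intro: has_derivative_at_withinI[OF D])
  qed
qed

lemma C1_critical_point_derivative_small:
  fixes h :: "'a::euclidean_space \<Rightarrow> 'b::euclidean_space"
  assumes "C_diff_on 1 N h" "open N" "0 \<in> N" "(h has_derivative (\<lambda>_. 0)) (at 0)" "\<epsilon> > 0"
  shows "\<forall>\<^sub>F x in nhds 0. \<forall>v. norm (frechet_derivative h (at x) v) \<le> \<epsilon> * norm v"
proof -
  let ?D = "\<lambda>x. frechet_derivative h (at x)"
  define e where "e = \<epsilon> / real DIM('a)"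
  have "e > 0"
    using assms(5) by (simp add: e_def)
  have D0: "?D 0 = (\<lambda>_. 0)"
    using frechet_derivative_at[OF assms(4)] by simp
  have "\<forall>\<^sub>F x in nhds 0. norm (?D x b) < e" for b
  proof -
    have "continuous_on N (\<lambda>x. ?D x b)"
      using assms(1) by simp
    then have "isCont (\<lambda>x. ?D x b) 0"
      using assms(2,3) by (simp add: continuous_on_eq_continuous_at)
    then have "((\<lambda>x. ?D x b) \<longlongrightarrow> ?D 0 b) (nhds 0)"
      unfolding isCont_def by (rule tendsto_at_iff_tendsto_nhds[THEN iffD1])
    then have "((\<lambda>x. norm (?D x b)) \<longlongrightarrow> 0) (nhds 0)"
      unfolding D0 by (rule tendsto_norm_zero)
    then show ?thesis
      using \<open>e > 0\<close> by (auto dest: order_tendstoD(2))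
  qed
  then have "\<forall>\<^sub>F x in nhds 0. \<forall>b\<in>Basis. norm (?D x b) < e"
    by (simp add: eventually_ball_finite)
  moreover have "\<forall>\<^sub>F x in nhds 0. x \<in> N"
    using assms(2,3) by (rule eventually_nhds_in_open)
  ultimately show ?thesis
  proof eventually_elim
    case (elim x)
    have "linear (?D x)"
      using C_diff_on_Suc_has_derivative[of 0 N h x] assms(1) elim has_derivative_linear by auto
    then show ?case
      using norm_linear_le_Basis[of "?D x" e] elim by (force simp: e_def)
  qed
qed

section \<open>Invariant graphs\<close>

text \<open>The invariance equation of a graph: differentiating \<open>x\<^sub>s(t) = h (x\<^sub>c(t))\<close> along a
  solution that stays on the graph.\<close>
lemma invariant_graph_equation:
  assumes inv: "locally_invariant F ((\<lambda>x. (h x, x)) ` N)" and "x \<in> N"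
    and h: "(h has_derivative D) (at x)"
  shows "fst (F (h x, x)) = D (snd (F (h x, x)))"
proof -
  obtain T z where T: "T > 0" and z0: "z 0 = (h x, x)"
    and z: "\<And>t. t \<in> {-T<..<T} \<Longrightarrow>
      (z has_vector_derivative F (z t)) (at t) \<and> z t \<in> (\<lambda>x. (h x, x)) ` N"
    using inv \<open>x \<in> N\<close> unfolding locally_invariant_def by (metis (no_types, lifting) image_eqI)
  have dz: "(z has_derivative (\<lambda>t. t *\<^sub>R F (h x, x))) (at 0)"
    using z[of 0] T z0 by (simp add: has_vector_derivative_def)
  have "((\<lambda>t. h (snd (z t))) has_derivative (\<lambda>t. D (snd (t *\<^sub>R F (h x, x))))) (at 0)"
    using has_derivative_compose[OF has_derivative_snd[OF dz], of h D] h z0 by simp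
  moreover have "((\<lambda>t. fst (z t)) has_derivative (\<lambda>t. fst (t *\<^sub>R F (h x, x)))) (at 0)"
    by (rule has_derivative_fst[OF dz])
  then have "((\<lambda>t. h (snd (z t))) has_derivative (\<lambda>t. fst (t *\<^sub>R F (h x, x)))) (at 0)"
  proof (rule has_derivative_transform_within_open)
    show "open {-T<..<T}" "0 \<in> {-T<..<T}"
      using T by auto
    show "fst (z t) = h (snd (z t))" if "t \<in> {-T<..<T}" for t
      using z[OF that] by auto
  qed
  ultimately have "(\<lambda>t. D (snd (t *\<^sub>R F (h x, x)))) = (\<lambda>t. fst (t *\<^sub>R F (h x, x)))"
    by (rule has_derivative_unique)
  then show ?thesis
    by (metis scaleR_one)
qed

section \<open>Estimates by the distance to a set\<close>

lemma dist_bigoE: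
  assumes "dist_bigo q E p"
  obtains C where "C \<ge> 0" "\<forall>\<^sub>F x in nhds 0. norm (q x) \<le> C * infdist x E * norm x ^ p"
proof -
  obtain C where C: "\<forall>\<^sub>F x in nhds 0. norm (q x) \<le> C * infdist x E * norm x ^ p"
    using assms unfolding dist_bigo_def by blast
  have "\<forall>\<^sub>F x in nhds 0. norm (q x) \<le> max C 0 * infdist x E * norm x ^ p"
    using C
  proof eventually_elim
    case (elim x)
    have "C * infdist x E * norm x ^ p \<le> max C 0 * infdist x E * norm x ^ p"
      by (intro mult_right_mono) (auto simp: infdist_nonneg)
    with elim show ?case
      by linarith
  qed
  then show thesis
    by (rule that[rotated]) simp
qed

text \<open>Near-minimisers replace a nearest point of \<^term>\<open>E\<close>, which need not exist as \<^term>\<open>E\<close> need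
  not be closed; since \<^term>\<open>0 \<in> E\<close>, points of norm at most \<open>3 * norm x\<close> suffice.\<close>
lemma le_infdist_of_le_dist:
  fixes x :: "'a::real_normed_vector"
  assumes "0 \<in> E" "x \<noteq> 0" "B \<ge> 0"
    and le: "\<And>e. e \<in> E \<Longrightarrow> norm e \<le> 3 * norm x \<Longrightarrow> a \<le> B * norm (x - e)"
  shows "a \<le> B * infdist x E"
proof (rule field_le_epsilon)
  fix \<epsilon> :: real assume "\<epsilon> > 0"
  define \<eta> where "\<eta> = min (norm x) (\<epsilon> / (B + 1))"
  have "\<eta> > 0"
    using assms \<open>\<epsilon> > 0\<close> by (simp add: \<eta>_def)
  have "\<eta> \<le> \<epsilon> / (B + 1)"
    by (simp add: \<eta>_def)
  then have "(B + 1) * \<eta> \<le> \<epsilon>"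
    using assms(3) by (simp add: field_simps)
  moreover have "B * \<eta> \<le> (B + 1) * \<eta>"
    using \<open>\<eta> > 0\<close> by (simp add: algebra_simps)
  ultimately have \<eta>: "B * \<eta> \<le> \<epsilon>" "\<eta> \<le> norm x"
    by (auto simp: \<eta>_def)
  have "(INF e\<in>E. dist x e) < infdist x E + \<eta>"
    using assms(1) \<open>\<eta> > 0\<close> by (subst infdist_notempty[symmetric]) auto
  then obtain e where e: "e \<in> E" "dist x e < infdist x E + \<eta>"
    using assms(1) by (subst (asm) cINF_less_iff) auto
  have "infdist x E \<le> norm x"
    using infdist_le[OF assms(1), of x] by simp
  then have "norm e \<le> 3 * norm x"
    using e(2) \<eta>(2) norm_triangle_sub[of e x] by (simp add: dist_norm norm_minus_commute)
  then have "a \<le> B * norm (x - e)"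
    using le e(1) by blast
  also have "\<dots> \<le> B * (infdist x E + \<eta>)"
    using e(2) assms(3) by (intro mult_left_mono) (auto simp: dist_norm)
  also have "\<dots> \<le> B * infdist x E + \<epsilon>"
    using \<eta>(1) by (simp add: algebra_simps)
  finally show "a \<le> B * infdist x E + \<epsilon>" .
qed

section \<open>Approximation of the center manifold\<close>

theorem mainTheorem4:
  fixes A :: "real ^ 's ^ 's"
    and f :: "(real ^ 's) \<times> (real ^ 'c) \<Rightarrow> real ^ 's"
    and g :: "(real ^ 's) \<times> (real ^ 'c) \<Rightarrow> real ^ 'c"
    and r :: nat
  assumes "hurwitz A"
    and "2 \<le> r"
    and "C_diff_on r UNIV f" and "C_diff_on r UNIV g"
    and "f (0, 0) = 0" and "(f has_derivative (\<lambda>_. 0)) (at (0, 0))"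
    and "g (0, 0) = 0" and "(g has_derivative (\<lambda>_. 0)) (at (0, 0))"
    and "\<not> ((0, 0) isolated_in equilibria (system_field A f g))"
  shows "\<exists>\<rho>>0. \<forall>U N h \<alpha> Ec.
           open U \<and> (0, 0) \<in> U \<and> U \<subseteq> ball (0, 0) \<rho> \<and>
           Ec = snd ` (equilibria (system_field A f g) \<inter> U) \<and>
           open N \<and> 0 \<in> N \<and>
           center_manifold_map (system_field A f g) N h \<and>
           (\<forall>xc\<in>N. norm (\<alpha> xc) \<le> norm xc) \<and>
           dist_bigo (\<lambda>xc. A *v \<alpha> xc + f (\<alpha> xc, xc)) Ec 1
           \<longrightarrow>
           dist_bigo (\<lambda>xc. h xc - \<alpha> xc) Ec 1 \<and>
           dist_bigo (\<lambda>xc. g (h xc, xc) - g (\<alpha> xc, xc)) Ec 2"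
proof -
  let ?F = "system_field A f g"
  obtain c where c: "c > 0" "\<And>y. c * norm y \<le> norm (A *v y)"
    using hurwitz_bounded_below[OF assms(1)] by blast
  have f': "(f has_derivative (\<lambda>_. 0)) (at 0)" and g': "(g has_derivative (\<lambda>_. 0)) (at 0)"
    using assms(6,8) by (simp_all add: zero_prod_def)
  obtain Kf \<delta>f where Kf: "Kf \<ge> 0" "\<delta>f > 0"
    "\<And>s x y. s \<le> \<delta>f \<Longrightarrow> norm x \<le> s \<Longrightarrow> norm y \<le> s \<Longrightarrow> norm (f x - f y) \<le> Kf * s * norm (x - y)"
    using C2_critical_point_Lipschitz[OF assms(2,3) f'] by metis
  obtain K \<delta>g where K: "K \<ge> 0" "\<delta>g > 0"
    "\<And>s x y. s \<le> \<delta>g \<Longrightarrow> norm x \<le> s \<Longrightarrow> norm y \<le> s \<Longrightarrow> norm (g x - g y) \<le> K * s * norm (x - y)"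
    using C2_critical_point_Lipschitz[OF assms(2,4) g'] by metis
  \<comment> \<open>Within the range of both Lipschitz bounds, and such that the Lipschitz constant
    \<open>Kf * \<rho>\<close> of \<^term>\<open>f\<close> is at most \<open>c / 2\<close>.\<close>
  define \<rho> where "\<rho> = min (min \<delta>f \<delta>g) (c / (2 * (Kf + 1)))"
  have \<rho>: "\<rho> > 0" "\<rho> \<le> \<delta>f" "\<rho> \<le> \<delta>g"
    using c(1) Kf K by (auto simp: \<rho>_def)
  have "\<rho> \<le> c / (2 * (Kf + 1))"
    by (simp add: \<rho>_def)
  then have "Kf * \<rho> \<le> c / 2"
    using Kf(1) \<rho>(1) by (simp add: field_simps)
  define G where "G y x = A *v y + f (y, x)" for y x
  have G_below: "c / 2 * norm (y - y') \<le> norm (G y x - G y' x)"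
    if "norm (y, x) \<le> \<rho>" "norm (y', x) \<le> \<rho>" for y y' x
  proof -
    have "norm (f (y, x) - f (y', x)) \<le> Kf * \<rho> * norm ((y, x) - (y', x))"
      using Kf(3) \<rho>(2) that by blast
    also have "\<dots> = Kf * \<rho> * norm (y - y')"
      by (simp add: norm_Pair)
    also have "\<dots> \<le> c / 2 * norm (y - y')"
      using \<open>Kf * \<rho> \<le> c / 2\<close> by (rule mult_right_mono) simp
    finally have "norm (f (y, x) - f (y', x)) \<le> c / 2 * norm (y - y')" .
    moreover have "c * norm (y - y') \<le> norm (A *v (y - y'))"
      by (rule c)
    moreover have "A *v (y - y') = (G y x - G y' x) - (f (y, x) - f (y', x))"
      by (simp add: G_def matrix_vector_mult_diff_distrib)
    then have "norm (A *v (y - y')) \<le> norm (G y x - G y' x) + norm (f (y, x) - f (y', x))"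
      by (metis norm_triangle_ineq4)
    ultimately show ?thesis
      by linarith
  qed
  show ?thesis
  proof (intro exI[of _ \<rho>] conjI[OF \<rho>(1)] allI impI, elim conjE)
    fix U N h \<alpha> Ec
    assume U: "open U" "(0, 0) \<in> U" "U \<subseteq> ball (0, 0) \<rho>" and Ec: "Ec = snd ` (equilibria ?F \<inter> U)"
      and N: "open N" "0 \<in> N" and cm: "center_manifold_map ?F N h"
      and \<alpha>: "\<forall>xc\<in>N. norm (\<alpha> xc) \<le> norm xc"
      and \<alpha>_res: "dist_bigo (\<lambda>xc. A *v \<alpha> xc + f (\<alpha> xc, xc)) Ec 1"
    let ?D = "\<lambda>x. frechet_derivative h (at x)"
    have h: "C_diff_on 1 N h" "h 0 = 0" "(h has_derivative (\<lambda>_. 0)) (at 0)"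
      and inv: "locally_invariant ?F ((\<lambda>x. (h x, x)) ` N)"
      using cm unfolding center_manifold_map_def by auto
    have D: "(h has_derivative ?D x) (at x)" if "x \<in> N" for x
      using C_diff_on_Suc_has_derivative[of 0 N h x] h(1) that by simp
    have invariance: "G (h x) x = ?D x (g (h x, x))" if "x \<in> N" for x
      using invariant_graph_equation[OF inv that D[OF that]] by (simp add: system_field_def G_def)

    \<comment> \<open>The bound on the derivative of \<^term>\<open>h\<close> that lets the lower bound for \<^term>\<open>G\<close> win at equilibria:
      \<open>\<epsilon> * (K * \<rho>) \<le> c / 4 < c / 2\<close>.\<close>
    define \<epsilon> where "\<epsilon> = min 1 (c / (4 * (K * \<rho> + 1)))"
    have pos: "K * \<rho> + 1 > 0"
      using K(1) \<rho>(1) by (simp add: add_nonneg_pos)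
    have \<epsilon>: "\<epsilon> > 0" "\<epsilon> \<le> 1"
      using c(1) pos by (auto simp: \<epsilon>_def)
    have "\<epsilon> \<le> c / (4 * (K * \<rho> + 1))"
      by (simp add: \<epsilon>_def)
    then have "\<epsilon> * (K * \<rho> + 1) \<le> c / 4"
      using pos by (simp add: field_simps)
    then have \<epsilon>K: "\<epsilon> * (K * \<rho>) \<le> c / 4"
      using \<epsilon>(1) by (simp add: algebra_simps)
    have "\<forall>\<^sub>F x in nhds 0. x \<in> N \<and> (\<forall>v. norm (?D x v) \<le> \<epsilon> * norm v)"
      using C1_critical_point_derivative_small[OF h(1) N h(3) \<epsilon>(1)] eventually_nhds_in_open[OF N]
      by eventually_elim simp
    then obtain d where d: "d > 0"
      "\<And>x. norm x < d \<Longrightarrow> x \<in> N" "\<And>x v. norm x < d \<Longrightarrow> norm (?D x v) \<le> \<epsilon> * norm v"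
      by (auto simp: eventually_nhds_metric)
    have h_Lip: "norm (h x - h y) \<le> norm (x - y)" if "norm x < d" "norm y < d" for x y
    proof -
      have "onorm (?D z) \<le> 1" if "z \<in> ball 0 d" for z
      proof (rule onorm_bound)
        fix v
        have "norm (?D z v) \<le> \<epsilon> * norm v"
          using d(3) that by simp
        also have "\<dots> \<le> 1 * norm v"
          using \<epsilon>(2) by (intro mult_right_mono) auto
        finally show "norm (?D z v) \<le> 1 * norm v" .
      qed simp
      then have "norm (h x - h y) \<le> 1 * norm (x - y)"
        using that d(2)
        by (intro differentiable_bound[of "ball 0 d" h ?D])
          (auto intro: has_derivative_at_withinI[OF D])
      then show ?thesis
        by simp
    qed
    have h_le: "norm (h x) \<le> norm x" if "norm x < d" for x
      using h_Lip[of x 0] that d(1) h(2) by simp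
    have pair_le: "norm (y, x) \<le> 2 * norm x" if "norm y \<le> norm x" for y :: "real ^ 's" and x :: "real ^ 'c"
      using norm_Pair_le[of y x] that by linarith

    \<comment> \<open>Equilibria near the origin lie on the graph of \<^term>\<open>h\<close>.\<close>
    have equilibrium: "g (h e, e) = 0" if e: "e \<in> Ec" "norm e < d" "norm e \<le> \<rho> / 2" for e
    proof -
      obtain y where y: "(y, e) \<in> U" "?F (y, e) = 0"
        using e(1) unfolding Ec equilibria_def by auto
      then have yF: "G y e = 0" "g (y, e) = 0"
        by (auto simp: system_field_def G_def zero_prod_def)
      have "norm (y, e) \<le> \<rho>"
        using y(1) U(3) by (auto simp: zero_prod_def[symmetric])
      moreover have he: "norm (h e, e) \<le> \<rho>"
        using pair_le[OF h_le] e by force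
      moreover have "norm ((h e, e) - (y, e)) = norm (h e - y)"
        by (simp add: norm_Pair)
      ultimately have g_le: "norm (g (h e, e)) \<le> K * \<rho> * norm (h e - y)"
        and G_le: "c / 2 * norm (h e - y) \<le> norm (G (h e) e)"
        using K(3)[OF \<rho>(3), of "(h e, e)" "(y, e)"] G_below[of "h e" e y] yF by auto
      have "norm (G (h e) e) \<le> \<epsilon> * norm (g (h e, e))"
        using invariance[of e] d(2,3) e(2) by simp
      also have "\<dots> \<le> \<epsilon> * (K * \<rho>) * norm (h e - y)"
        using g_le \<epsilon>(1) by (simp add: mult.assoc)
      also have "\<dots> \<le> c / 4 * norm (h e - y)"
        using \<epsilon>K by (intro mult_right_mono) auto
      finally have "c / 4 * norm (h e - y) \<le> 0"
        using G_le by simp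
      then have "h e = y"
        using c(1) by (simp add: mult_le_0_iff)
      then show ?thesis
        using yF by simp
    qed
    have "(0, 0) \<in> equilibria ?F"
      using assms(5,7) by (simp add: equilibria_def system_field_def zero_prod_def)
    then have "0 \<in> Ec"
      using U(2) unfolding Ec by force

    have g_le: "norm (g (h x, x)) \<le> 12 * K * norm x * infdist x Ec"
      if x: "x \<noteq> 0" "3 * norm x < d" "6 * norm x \<le> \<rho>" for x
    proof (rule le_infdist_of_le_dist[OF \<open>0 \<in> Ec\<close> x(1)])
      show "12 * K * norm x \<ge> 0"
        using K(1) by simp
      fix e assume e: "e \<in> Ec" "norm e \<le> 3 * norm x"
      have xd: "norm x < d" "norm e < d"
        using x(2) e(2) norm_ge_zero[of x] by linarith+
      have "norm (h x, x) \<le> 6 * norm x" "norm (h e, e) \<le> 6 * norm x"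
        using pair_le[OF h_le[OF xd(1)]] pair_le[OF h_le[OF xd(2)]] e(2) norm_ge_zero[of x]
        by linarith+
      then have "norm (g (h x, x) - g (h e, e)) \<le> K * (6 * norm x) * norm ((h x, x) - (h e, e))"
        using K(3) x(3) \<rho>(3) by force
      also have "\<dots> \<le> K * (6 * norm x) * (2 * norm (x - e))"
        using pair_le[OF h_Lip[OF xd]] K(1) by (intro mult_left_mono) auto
      finally show "norm (g (h x, x)) \<le> 12 * K * norm x * norm (x - e)"
        using equilibrium[of e] e x xd by (simp add: mult_ac)
    qed

    obtain C where C: "C \<ge> 0"
      "\<forall>\<^sub>F x in nhds 0. norm (A *v \<alpha> x + f (\<alpha> x, x)) \<le> C * infdist x Ec * norm x ^ 1"
      using dist_bigoE[OF \<alpha>_res] by blast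
    define C' where "C' = 2 / c * (12 * K + C)"
    define m where "m = min (d / 3) (\<rho> / 6)"
    have "m > 0"
      using d(1) \<rho>(1) by (simp add: m_def)
    then have "\<forall>\<^sub>F x in nhds (0 :: real ^ 'c). norm x < m"
      by (auto simp: eventually_nhds_metric)
    with C(2) have main: "\<forall>\<^sub>F x in nhds 0.
        norm (h x - \<alpha> x) \<le> C' * infdist x Ec * norm x \<and>
        norm (g (h x, x) - g (\<alpha> x, x)) \<le> 2 * K * C' * infdist x Ec * norm x ^ 2"
    proof eventually_elim
      case (elim x)
      have x: "3 * norm x < d" "6 * norm x \<le> \<rho>"
        using elim(2) by (auto simp: m_def)
      then have x': "norm x < d" "2 * norm x \<le> \<rho>"
        using norm_ge_zero[of x] by linarith+
      have "x \<in> N"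
        using d(2) x' by blast
      then have hx: "norm (h x, x) \<le> 2 * norm x" and ax: "norm (\<alpha> x, x) \<le> 2 * norm x"
        using pair_le h_le x'(1) \<alpha> by blast+
      have res: "norm (G (h x) x) \<le> 12 * K * norm x * infdist x Ec"
      proof (cases "x = 0")
        case True
        then show ?thesis
          using h(2) assms(5) by (simp add: G_def)
      next
        case False
        have "norm (G (h x) x) \<le> \<epsilon> * norm (g (h x, x))"
          using invariance[OF \<open>x \<in> N\<close>] d(3) x'(1) by simp
        also have "\<dots> \<le> norm (g (h x, x))"
          using \<epsilon> by (simp add: mult_left_le_one_le)
        finally show ?thesis
          using g_le[OF False x(1,2)] by linarith
      qed
      have "c / 2 * norm (h x - \<alpha> x) \<le> norm (G (h x) x - G (\<alpha> x) x)"
        using G_below hx ax x'(2) by force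
      also have "\<dots> \<le> norm (G (h x) x) + norm (G (\<alpha> x) x)"
        by (rule norm_triangle_ineq4)
      also have "\<dots> \<le> (12 * K + C) * infdist x Ec * norm x"
        using res elim(1) by (simp add: G_def algebra_simps)
      finally have diff: "norm (h x - \<alpha> x) \<le> C' * infdist x Ec * norm x"
        using c(1) by (simp add: C'_def field_simps)
      have "norm (g (h x, x) - g (\<alpha> x, x)) \<le> K * (2 * norm x) * norm ((h x, x) - (\<alpha> x, x))"
        using x'(2) \<rho>(3) by (intro K(3)[OF _ hx ax]) simp
      also have "\<dots> = K * (2 * norm x) * norm (h x - \<alpha> x)"
        by (simp add: norm_Pair)
      also have "\<dots> \<le> K * (2 * norm x) * (C' * infdist x Ec * norm x)"
        using diff K(1) by (intro mult_left_mono) auto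
      finally show ?case
        using diff by (simp add: power2_eq_square mult_ac)
    qed
    show "dist_bigo (\<lambda>xc. h xc - \<alpha> xc) Ec 1 \<and>
        dist_bigo (\<lambda>xc. g (h xc, xc) - g (\<alpha> xc, xc)) Ec 2"
      unfolding dist_bigo_def
      using main by (auto simp: eventually_conj_iff)
  qed
qed

end
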